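(* Let $n$ be a positive integer and consider an $n\times n\times n$ cube made up of $n^3$ unit cells. (1) If $n\equiv 0 \pmod 3$, then the cube can be tiled with trominoes. (2) If $n\equiv 1 \pmod 3$, then every singly deficient $n\times n\times n$ cube can be tiled with trominoes; that is, for every choice of one cell to be removed, the remaining $n^3-1$ cells can be tiled with trominoes. (3) If $n\equiv 2 \pmod 3$, then every doubly deficient $n\times n\times n$ cube can be tiled with trominoes; that is, for every choice of two distinct cells to be removed, the remaining $n^3-2$ cells can be tiled with trominoes.
   Context: Cells are the unit cubes of the integer grid, indexed by points of $\mathbb{Z}^3$. The $n\times n\times n$ cube is the set of cells indexed by $\{1,\dots,n\}^3$. A (three-dimensional) tromino is an L-shaped cluster of three cells: one cell together with two other cells meeting it on adjacent (perpendicular) faces, i.e. a set of the form $\{c,\ c+\epsilon e_i,\ c+\delta e_j\}$ with $c\in\mathbb{Z}^3$, $i\neq j$ in $\{1,2,3\}$, $\epsilon,\delta\in\{1,-1\}$, where $e_1,e_2,e_3$ are the standard basis vectors (all orientations are allowed; straight triples of cells are not trominoes). A cube is singly deficient if one of its $n^3$ cells is occupied or otherwise removed from consideration, and doubly deficient if two of its cells are. To tile a (possibly deficient) cube with trominoes means to partition the set of its cells, excluding any removed ones, into trominoes; the empty set is regarded as tiled by zero trominoes. *)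

theory Defs
  imports Main "HOL-Library.Disjoint_Sets" "HOL-Library.Product_Plus"
begin

type_synonym cell = "int \<times> int \<times> int"

definition std_basis :: "nat \<Rightarrow> cell" where
  "std_basis i = (of_bool (i = 1), of_bool (i = 2), of_bool (i = 3))"

definition scale :: "int \<Rightarrow> cell \<Rightarrow> cell" where
  "scale k = (\<lambda>(x, y, z). (k * x, k * y, k * z))"

definition tromino :: "cell set \<Rightarrow> bool" where
  "tromino T \<longleftrightarrow>
    (\<exists>c. \<exists>i\<in>{1, 2, 3}. \<exists>j\<in>{1, 2, 3}. \<exists>\<epsilon>\<in>{1, -1}. \<exists>\<delta>\<in>{1, -1}.
      i \<noteq> j \<and> T = {c, c + scale \<epsilon> (std_basis i), c + scale \<delta> (std_basis j)})"

definition cube :: "nat \<Rightarrow> cell set" where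
  "cube n = {1..int n} \<times> {1..int n} \<times> {1..int n}"

definition tileable :: "cell set \<Rightarrow> bool" where
  "tileable R \<longleftrightarrow> (\<exists>P. partition_on R P \<and> (\<forall>T\<in>P. tromino T))"

end

theory Submission
  imports Defs
begin

text \<open>
  Everything is reduced modulo 3. A box with one side divisible by 3 and the others at least 2 splits
  into 2 by 3 rectangles and cubes of side 3, all tileable (\<open>tileable_slab_x\<close>); this settles the case
  \<open>n mod 3 = 0\<close>. Consequently slabs of thickness 3 can be added to any box without spoiling
  a tiling (\<open>tileable_enlarge\<close>), so a deficient cube is tileable as soon as its removed cells lie in
  a tileable deficient sub-box whose distances to the faces are multiples of 3.

  One removed cell can always be enclosed in such a cube of side 4, hence the case \<open>n mod 3 = 1\<close> needs
  only \<open>n = 4\<close> (\<open>singly_tileable_cube_4\<close>). Two removed cells either fit into such a cube of side 5, or some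
  plane separates them and divides the cube into two parts, each with one removed cell, which shrink to
  boxes of size 5 by 5 by 4 (\<open>singly_tileable_5_5_4\<close>). What remains is the cube of side 2, which is cut
  into two squares, and the cube of side 5 (\<open>doubly_deficient_cube_5\<close>).

  In the cube of side 5 there are three situations. If one cell lies on a face that does not
  contain the other, the latter lies in a cube of side 4 whose complement is a shell containing
  the former (\<open>tileable_without_face\<close>). If the cells are close, they lie in a common 2 by 2 by 2 block, which is tileable
  without any two of its cells (\<open>tileable_without_close\<close>). Otherwise they lie in two squares in parallel layers
  at distance 2 (\<open>tileable_without_far\<close>). In all three, explicit tilings that leave out such flexible
  regions (a square, or a 2 by 2 by 2 block with one or no cell missing) handle many pairs of removed
  cells at once; up to symmetry twelve tilings of parts of the cube suffice.
\<close>

section \<open>Trominoes and isometries\<close>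

text \<open>Three cells form a tromino with corner \<open>p\<close> exactly when their squared distances are 1, 1 and 2.
This description is visibly invariant under isometries of the grid, needs no case distinction
on axes and signs, and can be evaluated on concrete cells.\<close>

fun sqdist :: "cell \<Rightarrow> cell \<Rightarrow> int" where
  "sqdist (x, y, z) (x', y', z') = (x - x')\<^sup>2 + (y - y')\<^sup>2 + (z - z')\<^sup>2"

definition bent :: "cell \<Rightarrow> cell \<Rightarrow> cell \<Rightarrow> bool" where
  "bent p q r \<longleftrightarrow> sqdist p q = 1 \<and> sqdist p r = 1 \<and> sqdist q r = 2"

text \<open>A sum of three integer squares equals 1 only if one square is 1 and the others vanish, so the
integer vectors of length one are the signed standard basis vectors.\<close>

lemma unit_vector_cases:
  fixes x y z :: int
  assumes "x\<^sup>2 + y\<^sup>2 + z\<^sup>2 = 1"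
  shows "\<exists>i\<in>{1, 2, 3}. \<exists>\<epsilon>\<in>{1, -1}. (x, y, z) = scale \<epsilon> (std_basis i)"
proof -
  have small: "u = -1 \<or> u = 0 \<or> u = 1" if "u\<^sup>2 \<le> 1" for u :: int
    using that abs_square_le_1 [of u] by auto
  have "x\<^sup>2 \<le> 1" "y\<^sup>2 \<le> 1" "z\<^sup>2 \<le> 1"
    using assms zero_le_power2 [of x] zero_le_power2 [of y] zero_le_power2 [of z] by linarith+
  then have "x = -1 \<or> x = 0 \<or> x = 1" "y = -1 \<or> y = 0 \<or> y = 1" "z = -1 \<or> z = 0 \<or> z = 1"
    using small by blast+
  then show ?thesis
    using assms by (elim disjE) (simp_all add: scale_def std_basis_def)
qed

lemma bent_imp_tromino:
  assumes "bent p q r"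
  shows "tromino {p, q, r}"
proof -
  have diff: "\<exists>i\<in>{1, 2, 3}. \<exists>\<epsilon>\<in>{1, -1}. s = p + scale \<epsilon> (std_basis i)"
    if s: "sqdist p s = 1" for s
  proof -
    obtain x y z where p: "p = (x, y, z)" by (cases p)
    obtain x' y' z' where s': "s = (x', y', z')" by (cases s)
    have "(x' - x)\<^sup>2 + (y' - y)\<^sup>2 + (z' - z)\<^sup>2 = 1"
      using s by (simp add: p s' power2_commute)
    from unit_vector_cases[OF this] obtain i \<epsilon> where
      i: "i \<in> {1, 2, 3}" "\<epsilon> \<in> {1, -1}" "(x' - x, y' - y, z' - z) = scale \<epsilon> (std_basis i)"
      by blast
    have "s = p + (x' - x, y' - y, z' - z)" by (simp add: p s')
    then show ?thesis using i by metis
  qed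
  obtain i \<epsilon> where i: "i \<in> {1, 2, 3}" "\<epsilon> \<in> {1, -1}" "q = p + scale \<epsilon> (std_basis i)"
    using diff assms unfolding bent_def by blast
  obtain j \<delta> where j: "j \<in> {1, 2, 3}" "\<delta> \<in> {1, -1}" "r = p + scale \<delta> (std_basis j)"
    using diff assms unfolding bent_def by blast
  \<comment> \<open>Two steps along the same axis end at squared distance 0 or 4, not 2.\<close>
  have "i \<noteq> j"
  proof
    assume "i = j"
    then have "sqdist q r = 0 \<or> sqdist q r = 4"
      using i j by (cases p) (auto simp: scale_def std_basis_def)
    then show False using assms by (auto simp: bent_def)
  qed
  then show ?thesis
    unfolding tromino_def using i j by blast
qed

lemma tromino_iff_bent: "tromino T \<longleftrightarrow> (\<exists>p q r. T = {p, q, r} \<and> bent p q r)"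
proof
  assume "tromino T"
  then obtain c i j \<epsilon> \<delta> where *: "i \<in> {1, 2, 3}" "j \<in> {1, 2, 3}" "\<epsilon> \<in> {1, -1}" "\<delta> \<in> {1, -1}"
    "i \<noteq> j" "T = {c, c + scale \<epsilon> (std_basis i), c + scale \<delta> (std_basis j)}"
    unfolding tromino_def by blast
  have "bent c (c + scale \<epsilon> (std_basis i)) (c + scale \<delta> (std_basis j))"
    using *(1-5) by (cases c) (auto simp: bent_def scale_def std_basis_def)
  with * show "\<exists>p q r. T = {p, q, r} \<and> bent p q r" by blast
qed (auto intro: bent_imp_tromino)

lemma tileable_empty: "tileable {}"
  unfolding tileable_def partition_on_def by (intro exI[of _ "{}"]) auto

lemma tileable_tromino: "bent p q r \<Longrightarrow> tileable {p, q, r}"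
  unfolding tileable_def using bent_imp_tromino
  by (intro exI[of _ "{{p, q, r}}"]) (auto intro: partition_on_space)

lemma tileable_Union:
  assumes "\<And>i. i \<in> I \<Longrightarrow> tileable (R i)"
    and "disjoint_family_on R I"
  shows "tileable (\<Union>i\<in>I. R i)"
proof -
  obtain P where P: "\<And>i. i \<in> I \<Longrightarrow> partition_on (R i) (P i) \<and> (\<forall>T\<in>P i. tromino T)"
    using assms(1) unfolding tileable_def by metis
  have "partition_on (\<Union>i\<in>I. R i) (\<Union>i\<in>I. P i)"
  proof (rule partition_onI)
    show "\<Union> (\<Union>i\<in>I. P i) = (\<Union>i\<in>I. R i)"
    proof -
      have "\<Union> (P i) = R i" if "i \<in> I" for i using P[OF that] by (simp add: partition_on_def)
      then show ?thesis by (simp add: set_eq_iff)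
    qed
    show "disjnt S T" if ST: "S \<in> (\<Union>i\<in>I. P i)" "T \<in> (\<Union>i\<in>I. P i)" "S \<noteq> T" for S T
    proof -
      obtain i j where ij: "i \<in> I" "j \<in> I" "S \<in> P i" "T \<in> P j" using ST(1,2) by blast
      show ?thesis
      proof (cases "i = j")
        case True
        then show ?thesis
          using P[of i] ij ST(3) by (auto simp: partition_on_def disjoint_def disjnt_def)
      next
        case False
        then have "R i \<inter> R j = {}" using assms(2) ij by (auto simp: disjoint_family_on_def)
        moreover have "S \<subseteq> R i" "T \<subseteq> R j" using P ij by (auto simp: partition_on_def)
        ultimately show ?thesis by (auto simp: disjnt_def)
      qed
    qed
    show "{} \<notin> (\<Union>i\<in>I. P i)" using P by (auto simp: partition_on_def)
  qed
  then show ?thesis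
    unfolding tileable_def using P by (intro exI[of _ "\<Union>i\<in>I. P i"]) blast
qed

lemma tileable_Un:
  assumes "tileable R" "tileable S" "R \<inter> S = {}"
  shows "tileable (R \<union> S)"
proof -
  have "tileable (\<Union>b\<in>{True, False}. if b then R else S)"
    using assms by (intro tileable_Union) (auto simp: disjoint_family_on_def)
  then show ?thesis by (simp add: Un_commute)
qed

text \<open>Distance determines equality of cells, so a distance-preserving map is injective and carries a
partition into trominoes to another one.\<close>

lemma tileable_isometry:
  assumes f: "\<And>p q. sqdist (f p) (f q) = sqdist p q" and R: "tileable R"
  shows "tileable (f ` R)"
proof -
  have sq0: "sqdist p q = 0 \<longleftrightarrow> p = q" for p q
  proof (cases p, cases q)
    fix x y z x' y' z'
    assume "p = (x, y, z)" "q = (x', y', z')"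
    then show ?thesis
      using zero_le_power2[of "x - x'"] zero_le_power2[of "y - y'"] zero_le_power2[of "z - z'"]
      by (auto simp: add_nonneg_eq_0_iff)
  qed
  have inj: "inj f"
    using sq0 f by (metis injI)
  obtain P where P: "partition_on R P" "\<forall>T\<in>P. tromino T"
    using R unfolding tileable_def by blast
  have "partition_on (f ` R) ((`) f ` P - {{}})"
    using P(1) by (rule partition_on_inj_image) (rule inj_on_subset[OF inj subset_UNIV])
  moreover have "tromino (f ` T)" if "T \<in> P" for T
    using P(2) that f unfolding tromino_iff_bent bent_def
    by (metis image_empty image_insert)
  ultimately show ?thesis
    unfolding tileable_def by blast
qed

fun in_box :: "cell \<Rightarrow> cell \<Rightarrow> cell \<Rightarrow> bool" where
  "in_box (a, b, c) (a', b', c') (x, y, z) \<longleftrightarrow>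
     a \<le> x \<and> x < a' \<and> b \<le> y \<and> y < b' \<and> c \<le> z \<and> z < c'"

definition box :: "cell \<Rightarrow> cell \<Rightarrow> cell set" where
  "box p q = {s. in_box p q s}"

lemma mem_box [simp]: "s \<in> box p q \<longleftrightarrow> in_box p q s"
  by (simp add: box_def)

lemma tileable_translate:
  "tileable ((+) v ` R) \<longleftrightarrow> tileable R" for v :: cell
proof -
  have iso: "sqdist (v + p) (v + q) = sqdist p q" for v p q
    by (cases v; cases p; cases q) simp
  have "(+) (- v) ` (+) v ` R = R" by (simp add: image_image)
  then show ?thesis
    using tileable_isometry[of "(+) v" R] tileable_isometry[of "(+) (- v)" "(+) v ` R"] iso
    by metis
qed

fun swap_xy :: "cell \<Rightarrow> cell" where "swap_xy (x, y, z) = (y, x, z)"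
fun swap_yz :: "cell \<Rightarrow> cell" where "swap_yz (x, y, z) = (x, z, y)"
fun mirror_x :: "int \<Rightarrow> cell \<Rightarrow> cell" where "mirror_x k (x, y, z) = (k - x, y, z)"
fun mirror_y :: "int \<Rightarrow> cell \<Rightarrow> cell" where "mirror_y k (x, y, z) = (x, k - y, z)"
fun mirror_z :: "int \<Rightarrow> cell \<Rightarrow> cell" where "mirror_z k (x, y, z) = (x, y, k - z)"

text \<open>The three reflections and two transpositions of coordinates are all the symmetries that
the reductions to normal position below use.\<close>

lemma involutive:
  "swap_xy (swap_xy p) = p" "swap_yz (swap_yz p) = p"
  "mirror_x k (mirror_x k p) = p" "mirror_y k (mirror_y k p) = p" "mirror_z k (mirror_z k p) = p"
  by (cases p; simp)+

lemma image_box: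
  "swap_xy ` box (a, b, c) (a', b', c') = box (b, a, c) (b', a', c')"
  "swap_yz ` box (a, b, c) (a', b', c') = box (a, c, b) (a', c', b')"
  "mirror_x k ` box (a, b, c) (a', b', c') = box (k + 1 - a', b, c) (k + 1 - a, b', c')"
  "mirror_y k ` box (a, b, c) (a', b', c') = box (a, k + 1 - b', c) (a', k + 1 - b, c')"
  "mirror_z k ` box (a, b, c) (a', b', c') = box (a, b, k + 1 - c') (a', b', k + 1 - c)"
proof -
  have eq: "f ` A = B" if "\<And>p. f (f p) = p" "\<And>x y z. f (x, y, z) \<in> A \<longleftrightarrow> (x, y, z) \<in> B"
    for f :: "cell \<Rightarrow> cell" and A B
  proof (rule set_eqI)
    fix s :: cell
    have "s \<in> f ` A \<longleftrightarrow> f s \<in> A" using that(1) by (metis image_iff)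
    then show "s \<in> f ` A \<longleftrightarrow> s \<in> B" using that(2) by (cases s) simp
  qed
  show "swap_xy ` box (a, b, c) (a', b', c') = box (b, a, c) (b', a', c')"
    by (rule eq) (auto simp: involutive)
  show "swap_yz ` box (a, b, c) (a', b', c') = box (a, c, b) (a', c', b')"
    by (rule eq) (auto simp: involutive)
  show "mirror_x k ` box (a, b, c) (a', b', c') = box (k + 1 - a', b, c) (k + 1 - a, b', c')"
    by (rule eq) (auto simp: involutive)
  show "mirror_y k ` box (a, b, c) (a', b', c') = box (a, k + 1 - b', c) (a', k + 1 - b, c')"
    by (rule eq) (auto simp: involutive)
  show "mirror_z k ` box (a, b, c) (a', b', c') = box (a, b, k + 1 - c') (a', b', k + 1 - c)"
    by (rule eq) (auto simp: involutive)
qed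

lemma tileable_involution:
  assumes iso: "\<And>p q. sqdist (f p) (f q) = sqdist p q" and inv: "\<And>p. f (f p) = p"
  shows "tileable (B - S) \<longleftrightarrow> tileable (f ` B - f ` S)"
proof -
  have "inj f" using inv by (metis injI)
  then have "f ` (B - S) = f ` B - f ` S" by (rule image_set_diff)
  moreover have "f ` f ` (B - S) = B - S" using inv by (simp add: image_image)
  ultimately show ?thesis using tileable_isometry[OF iso] by metis
qed

lemma tileable_diff_swap_xy:
  "tileable (box (a, b, c) (a', b', c') - S) \<longleftrightarrow> tileable (box (b, a, c) (b', a', c') - swap_xy ` S)"
proof -
  have "sqdist (swap_xy p) (swap_xy q) = sqdist p q" for p q
    by (cases p; cases q) (simp add: power2_commute)
  then show ?thesis
    using tileable_involution[of "swap_xy" "box (a, b, c) (a', b', c')" S] by (simp add: involutive image_box)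
qed

lemma tileable_diff_swap_yz:
  "tileable (box (a, b, c) (a', b', c') - S) \<longleftrightarrow> tileable (box (a, c, b) (a', c', b') - swap_yz ` S)"
proof -
  have "sqdist (swap_yz p) (swap_yz q) = sqdist p q" for p q
    by (cases p; cases q) (simp add: power2_commute)
  then show ?thesis
    using tileable_involution[of "swap_yz" "box (a, b, c) (a', b', c')" S] by (simp add: involutive image_box)
qed

lemma tileable_diff_mirror_x:
  "tileable (box (a, b, c) (a', b', c') - S) \<longleftrightarrow> tileable (box (k + 1 - a', b, c) (k + 1 - a, b', c') - mirror_x k ` S)"
proof -
  have "sqdist (mirror_x k p) (mirror_x k q) = sqdist p q" for p q
    by (cases p; cases q) (simp add: power2_commute)
  then show ?thesis
    using tileable_involution[of "mirror_x k" "box (a, b, c) (a', b', c')" S] by (simp add: involutive image_box)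
qed

lemma tileable_diff_mirror_y:
  "tileable (box (a, b, c) (a', b', c') - S) \<longleftrightarrow> tileable (box (a, k + 1 - b', c) (a', k + 1 - b, c') - mirror_y k ` S)"
proof -
  have "sqdist (mirror_y k p) (mirror_y k q) = sqdist p q" for p q
    by (cases p; cases q) (simp add: power2_commute)
  then show ?thesis
    using tileable_involution[of "mirror_y k" "box (a, b, c) (a', b', c')" S] by (simp add: involutive image_box)
qed

lemma tileable_diff_mirror_z:
  "tileable (box (a, b, c) (a', b', c') - S) \<longleftrightarrow> tileable (box (a, b, k + 1 - c') (a', b', k + 1 - c) - mirror_z k ` S)"
proof -
  have "sqdist (mirror_z k p) (mirror_z k q) = sqdist p q" for p q
    by (cases p; cases q) (simp add: power2_commute)
  then show ?thesis
    using tileable_involution[of "mirror_z k" "box (a, b, c) (a', b', c')" S] by (simp add: involutive image_box)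
qed

section \<open>Cutting and stacking boxes\<close>

lemma tileable_box_swap_xy: "tileable (box (a, b, c) (a', b', c')) \<longleftrightarrow> tileable (box (b, a, c) (b', a', c'))"
  using tileable_diff_swap_xy[where S = "{}"] by simp

lemma tileable_box_swap_yz: "tileable (box (a, b, c) (a', b', c')) \<longleftrightarrow> tileable (box (a, c, b) (a', c', b'))"
  using tileable_diff_swap_yz[where S = "{}"] by simp

lemma tileable_cut_x:
  assumes "tileable (box (a, b, c) (m, b', c') - S)" "tileable (box (m, b, c) (a', b', c') - S)"
    and "a \<le> m" "m \<le> a'"
  shows "tileable (box (a, b, c) (a', b', c') - S)"
proof -
  have "box (a, b, c) (a', b', c') - S
      = (box (a, b, c) (m, b', c') - S) \<union> (box (m, b, c) (a', b', c') - S)"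
    using assms(3,4) by auto
  moreover have "(box (a, b, c) (m, b', c') - S) \<inter> (box (m, b, c) (a', b', c') - S) = {}" by auto
  ultimately show ?thesis using tileable_Un[OF assms(1,2)] by simp
qed

lemma tileable_cut_y:
  assumes "tileable (box (a, b, c) (a', m, c') - S)" "tileable (box (a, m, c) (a', b', c') - S)"
    and "b \<le> m" "m \<le> b'"
  shows "tileable (box (a, b, c) (a', b', c') - S)"
proof -
  have "box (a, b, c) (a', b', c') - S
      = (box (a, b, c) (a', m, c') - S) \<union> (box (a, m, c) (a', b', c') - S)"
    using assms(3,4) by auto
  moreover have "(box (a, b, c) (a', m, c') - S) \<inter> (box (a, m, c) (a', b', c') - S) = {}" by auto
  ultimately show ?thesis using tileable_Un[OF assms(1,2)] by simp
qed

lemma tileable_cut_z: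
  assumes "tileable (box (a, b, c) (a', b', m) - S)" "tileable (box (a, b, m) (a', b', c') - S)"
    and "c \<le> m" "m \<le> c'"
  shows "tileable (box (a, b, c) (a', b', c') - S)"
proof -
  have "box (a, b, c) (a', b', c') - S
      = (box (a, b, c) (a', b', m) - S) \<union> (box (a, b, m) (a', b', c') - S)"
    using assms(3,4) by auto
  moreover have "(box (a, b, c) (a', b', m) - S) \<inter> (box (a, b, m) (a', b', c') - S) = {}" by auto
  ultimately show ?thesis using tileable_Un[OF assms(1,2)] by simp
qed

lemma tileable_stack_z:
  assumes slab: "\<And>m. tileable (box (a, b, m) (a', b', m + d))"
    and "d dvd c' - c" "c \<le> c'" "d > 0"
  shows "tileable (box (a, b, c) (a', b', c'))"
proof -
  have *: "tileable (box (a, b, c) (a', b', c + d * int k))" for k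
  proof (induction k)
    case 0
    have "box (a, b, c) (a', b', c) = {}" by auto
    then show ?case by (simp add: tileable_empty)
  next
    case (Suc k)
    have "tileable (box (a, b, c) (a', b', c + d * int k + d) - {})"
      by (rule tileable_cut_z[where m = "c + d * int k"]) (use Suc slab \<open>d > 0\<close> in auto)
    then show ?case by (simp add: algebra_simps)
  qed
  obtain e where e: "c' - c = d * e" using assms(2) by (elim dvdE)
  then have "e \<ge> 0" using assms(3,4) by (metis diff_ge_0_iff_ge zero_le_mult_iff not_less)
  then have "c' = c + d * int (nat e)" using e by simp
  then show ?thesis using * by metis
qed

lemma tileable_stack_y:
  assumes slab: "\<And>m. tileable (box (a, m, c) (a', m + d, c'))"
    and "d dvd b' - b" "b \<le> b'" "d > 0"
  shows "tileable (box (a, b, c) (a', b', c'))"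
proof -
  have "tileable (box (a, c, m) (a', c', m + d))" for m
    using slab tileable_box_swap_yz by blast
  then have "tileable (box (a, c, b) (a', c', b'))"
    using assms(2-4) by (rule tileable_stack_z)
  then show ?thesis using tileable_box_swap_yz by blast
qed

lemma tileable_stack_x:
  assumes slab: "\<And>m. tileable (box (m, b, c) (m + d, b', c'))"
    and "d dvd a' - a" "a \<le> a'" "d > 0"
  shows "tileable (box (a, b, c) (a', b', c'))"
proof -
  have "tileable (box (b, m, c) (b', m + d, c'))" for m
    using slab tileable_box_swap_xy by blast
  then have "tileable (box (b, a, c) (b', a', c'))"
    using assms(2-4) by (rule tileable_stack_y)
  then show ?thesis using tileable_box_swap_xy by blast
qed

lemma tileable_3_2_1: "tileable (box (a, b, c) (a + 3, b + 2, c + 1))"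
proof -
  have "box (a, b, c) (a + 3, b + 2, c + 1)
      = {(a, b, c), (a + 1, b, c), (a, b + 1, c)}
        \<union> {(a + 2, b + 1, c), (a + 1, b + 1, c), (a + 2, b, c)}" (is "_ = ?R")
  proof (rule set_eqI)
    fix s :: cell
    obtain x y z where s: "s = (x, y, z)" by (cases s)
    have "s \<in> box (a, b, c) (a + 3, b + 2, c + 1)
        \<longleftrightarrow> (x = a \<or> x = a + 1 \<or> x = a + 2) \<and> (y = b \<or> y = b + 1) \<and> z = c"
      unfolding s mem_box in_box.simps by presburger
    also have "\<dots> \<longleftrightarrow> s \<in> ?R" unfolding s by blast
    finally show "s \<in> box (a, b, c) (a + 3, b + 2, c + 1) \<longleftrightarrow> s \<in> ?R" .
  qed
  also have "tileable \<dots>"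
    by (intro tileable_Un tileable_tromino) (auto simp: bent_def)
  finally show ?thesis .
qed

lemma tileable_3_even:
  assumes "even (b' - b) \<or> even (c' - c)" "b \<le> b'" "c \<le> c'"
  shows "tileable (box (a, b, c) (a + 3, b', c'))"
proof -
  have *: "tileable (box (a, b, c) (a + 3, b', c'))"
    if "even (b' - b)" "b \<le> b'" "c \<le> c'" for b b' c c'
  proof (rule tileable_stack_y[where d = 2])
    fix m
    show "tileable (box (a, m, c) (a + 3, m + 2, c'))"
      by (rule tileable_stack_z[where d = 1]) (use that tileable_3_2_1 in auto)
  qed (use that in auto)
  show ?thesis
    using assms *[of b' b c c'] *[of c' c b b'] tileable_box_swap_yz[of a b c] by blast
qed

section \<open>Tilings given by pictures\<close>

text \<open>An explicit tiling of part of a cube is drawn as a list of layers, one per value of the first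
coordinate. A layer is a list of rows, and a row a string. Equal letters mark the three cells of a
tromino, and dots the cells left out. Disjointness of the pieces is then automatic, and only
the shape of each piece and the set of dots have to be checked by computation.\<close>

definition label :: "string list list \<Rightarrow> cell \<Rightarrow> char" where
  "label pic = (\<lambda>(x, y, z). pic ! nat (x - 1) ! nat (y - 1) ! nat (z - 1))"

definition grid :: "int \<Rightarrow> cell list" where
  "grid n = [(x, y, z). x \<leftarrow> [1..n], y \<leftarrow> [1..n], z \<leftarrow> [1..n]]"

fun is_tromino :: "cell list \<Rightarrow> bool" where
  "is_tromino [p, q, r] \<longleftrightarrow> bent p q r \<or> bent q p r \<or> bent r p q"
| "is_tromino _ \<longleftrightarrow> False"

text \<open>The cells left out are described by boxes, each given by its lower corner (included) and its upper
corner (excluded).\<close>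

definition depicts :: "int \<Rightarrow> (cell \<times> cell) list \<Rightarrow> string list list \<Rightarrow> bool" where
  "depicts n holes pic \<longleftrightarrow>
     (let cs = map (\<lambda>s. (label pic s, s)) (grid n) in
       list_all (\<lambda>(l, s). l = CHR ''.'' \<longleftrightarrow> list_ex (\<lambda>(p, q). in_box p q s) holes) cs \<and>
       list_all (\<lambda>l. l = CHR ''.'' \<or> is_tromino (map snd (filter (\<lambda>(l', s). l' = l) cs)))
         (remdups (map fst cs)))"

lemma tileable_is_tromino: "is_tromino cs \<Longrightarrow> tileable (set cs)"
proof (induction cs rule: is_tromino.induct)
  case (1 p q r)
  have "{q, p, r} = {p, q, r}" "{r, p, q} = {p, q, r}" by blast+
  then show ?case
    using 1 tileable_tromino[of p q r] tileable_tromino[of q p r] tileable_tromino[of r p q]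
    by auto
qed auto

lemma set_grid: "set (grid n) = box (1, 1, 1) (n + 1, n + 1, n + 1)"
  by (auto simp: grid_def image_iff)

lemma tileable_picture:
  assumes "depicts n holes pic"
  shows "tileable (box (1, 1, 1) (n + 1, n + 1, n + 1) - (\<Union>(p, q)\<in>set holes. box p q))"
proof -
  define fibre where "fibre l = {s \<in> set (grid n). label pic s = l}" for l
  define L where "L = label pic ` set (grid n) - {CHR ''.''}"
  have "tileable (fibre l)" if "l \<in> L" for l
  proof -
    have "is_tromino (map snd (filter (\<lambda>(l', s). l' = l) (map (\<lambda>s. (label pic s, s)) (grid n))))"
      using assms that by (auto simp: depicts_def Let_def list_all_iff L_def)
    from tileable_is_tromino[OF this] show ?thesis
      by (rule arg_cong[where f = tileable, THEN iffD1, rotated]) (force simp: fibre_def)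
  qed
  then have "tileable (\<Union>l\<in>L. fibre l)"
    by (rule tileable_Union) (auto simp: disjoint_family_on_def fibre_def)
  also have "(\<Union>l\<in>L. fibre l) = {s \<in> set (grid n). label pic s \<noteq> CHR ''.''}"
    by (auto simp: L_def fibre_def)
  also have "\<dots> = {s \<in> set (grid n). \<not> (\<exists>(p, q)\<in>set holes. in_box p q s)}"
    using assms by (auto simp: depicts_def Let_def list_all_iff list_ex_iff)
  also have "\<dots> = box (1, 1, 1) (n + 1, n + 1, n + 1) - (\<Union>(p, q)\<in>set holes. box p q)"
    unfolding set_grid by auto
  finally show ?thesis .
qed

text \<open>The dots of the shell pictures comprise the cube of side 4 at the far corner and one flexible region at
the face \<open>x = 1\<close>, those of the far pictures a square in each of two parallel layers, and those of the
close pictures a 2 by 2 by 2 block. The digits in the names are the varying coordinates of the lower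
corner of the (first) flexible region.\<close>

lemma cube_3_picture: "depicts 3 []
  [[''aab'', ''acd'', ''ccd''],
   [''ebb'', ''ffd'', ''ggh''],
   [''eei'', ''fii'', ''ghh'']]"
  by code_simp

lemma cube_4_picture: "depicts 4 [((1, 1, 1), (3, 3, 2)), ((2, 1, 2), (3, 3, 3)), ((1, 2, 2), (2, 3, 3))]
  [[''.aab'', ''..cb'', ''decf'', ''degg''],
   [''..ab'', ''..ch'', ''iijf'', ''degf''],
   [''klmh'', ''klmh'', ''nijj'', ''nopp''],
   [''klqq'', ''rrmq'', ''nrss'', ''oops'']]"
  by code_simp

lemma shell_picture_11: "depicts 5 [((2, 2, 2), (6, 6, 6)), ((1, 1, 1), (3, 3, 3))]
  [[''..aab'', ''..cdd'', ''eeccd'', ''efghh'', ''ffggh''],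
   [''..abb'', ''.....'', ''i....'', ''j....'', ''j....''],
   [''kllmm'', ''k....'', ''i....'', ''i....'', ''j....''],
   [''knlom'', ''p....'', ''q....'', ''q....'', ''r....''],
   [''pnnoo'', ''p....'', ''q....'', ''r....'', ''r....'']]"
  by code_simp

lemma shell_picture_13: "depicts 5 [((2, 2, 2), (6, 6, 6)), ((1, 1, 3), (2, 3, 5))]
  [[''aa..b'', ''ac..b'', ''dccee'', ''ddfge'', ''hffgg''],
   [''ijjkb'', ''l....'', ''l....'', ''h....'', ''h....''],
   [''iijkk'', ''m....'', ''l....'', ''n....'', ''n....''],
   [''mopqq'', ''m....'', ''r....'', ''s....'', ''n....''],
   [''ooppq'', ''r....'', ''r....'', ''s....'', ''s....'']]"
  by code_simp

lemma shell_picture_14: "depicts 5 [((2, 2, 2), (6, 6, 6)), ((1, 1, 4), (2, 3, 6))]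
  [[''abb..'', ''aab..'', ''cddee'', ''cfdge'', ''hffgg''],
   [''iijkk'', ''i....'', ''c....'', ''h....'', ''h....''],
   [''lljjk'', ''m....'', ''m....'', ''n....'', ''n....''],
   [''olpqq'', ''m....'', ''r....'', ''s....'', ''n....''],
   [''ooppq'', ''r....'', ''r....'', ''s....'', ''s....'']]"
  by code_simp

lemma shell_picture_33: "depicts 5 [((2, 2, 2), (6, 6, 6)), ((1, 3, 3), (2, 5, 5))]
  [[''aabcc'', ''abbdd'', ''ee..d'', ''fg..h'', ''fgghh''],
   [''ijjck'', ''i....'', ''e....'', ''l....'', ''f....''],
   [''imjkk'', ''n....'', ''n....'', ''l....'', ''l....''],
   [''mmopp'', ''n....'', ''q....'', ''r....'', ''r....''],
   [''ssoop'', ''s....'', ''q....'', ''q....'', ''r....'']]"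
  by code_simp

lemma shell_picture_44: "depicts 5 [((2, 2, 2), (6, 6, 6)), ((1, 4, 4), (2, 6, 6))]
  [[''abbcc'', ''adeff'', ''ddeef'', ''ggh..'', ''ghh..''],
   [''iibjc'', ''a....'', ''k....'', ''k....'', ''l....''],
   [''immjj'', ''n....'', ''k....'', ''l....'', ''l....''],
   [''nmopp'', ''n....'', ''q....'', ''r....'', ''r....''],
   [''ssoop'', ''s....'', ''q....'', ''q....'', ''r....'']]"
  by code_simp

lemma shell_picture_24: "depicts 5 [((2, 2, 2), (6, 6, 6)), ((1, 2, 4), (2, 4, 6))]
  [[''abbcc'', ''dee..'', ''dfe..'', ''ffghh'', ''iiggh''],
   [''aabcj'', ''d....'', ''k....'', ''k....'', ''i....''],
   [''llmjj'', ''l....'', ''k....'', ''n....'', ''n....''],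
   [''opmmq'', ''r....'', ''r....'', ''s....'', ''n....''],
   [''oppqq'', ''o....'', ''r....'', ''s....'', ''s....'']]"
  by code_simp

lemma far_picture_11: "depicts 5 [((1, 1, 2), (3, 3, 3)), ((1, 1, 4), (3, 3, 5))]
  [[''a.b.c'', ''a.b.c'', ''ddefg'', ''heefg'', ''hhijj''],
   [''k.l.m'', ''a.b.c'', ''dnnog'', ''pqqfr'', ''pqiij''],
   [''kllmm'', ''ksstt'', ''usnor'', ''pvvor'', ''wwvxx''],
   [''yzAAB'', ''uCCtD'', ''uEFFG'', ''HEIJG'', ''HwKxL''],
   [''yzABB'', ''yzCDD'', ''MMIFG'', ''MEIJL'', ''HKKJL'']]"
  by code_simp

lemma far_picture_12: "depicts 5 [((1, 2, 2), (3, 4, 3)), ((1, 3, 4), (3, 5, 5))]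
  [[''abcdd'', ''a.cee'', ''f.g.h'', ''iig.h'', ''ijjkk''],
   [''bbcld'', ''a.mme'', ''f.g.h'', ''fno.p'', ''qjokp''],
   [''rssll'', ''tsmuv'', ''twwvv'', ''nnwxx'', ''qqoxp''],
   [''rryyz'', ''tAuuz'', ''BACDE'', ''FGCCH'', ''FGGII''],
   [''JKKyz'', ''JJKDE'', ''BALDE'', ''BMLLH'', ''FMMIH'']]"
  by code_simp

lemma far_picture_22: "depicts 5 [((2, 2, 2), (4, 4, 3)), ((3, 3, 4), (5, 5, 5))]
  [[''aabbc'', ''daebc'', ''fgehh'', ''fggih'', ''jjiik''],
   [''lmmno'', ''d.mpc'', ''d.eqr'', ''fsqqk'', ''jsstk''],
   [''lunno'', ''l.ppo'', ''v.w.r'', ''xyw.r'', ''xyttz''],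
   [''AuBCD'', ''AuBEE'', ''vvw.E'', ''xyF.z'', ''GHIIz''],
   [''AJBCD'', ''KJJCD'', ''KKFLL'', ''GHFLM'', ''GHIMM'']]"
  by code_simp

lemma close_picture_112: "depicts 5 [((1, 1, 2), (3, 3, 4))]
  [[''a..bb'', ''a..cb'', ''deccf'', ''ddghi'', ''jkkhi''],
   [''a..ll'', ''m..lf'', ''megnf'', ''oeghi'', ''jjkpp''],
   [''qrrss'', ''ttruu'', ''mtnnv'', ''oowwv'', ''xyywp''],
   [''qzABs'', ''qCBBu'', ''DEFGH'', ''DFFGv'', ''xxyIJ''],
   [''zzAKK'', ''CCAKH'', ''EELGH'', ''DMLLJ'', ''MMIIJ'']]"
  by code_simp

lemma close_picture_122: "depicts 5 [((1, 2, 2), (3, 4, 4))]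
  [[''abbcc'', ''a..dd'', ''e..df'', ''egghh'', ''iijhk''],
   [''lmbnc'', ''a..nf'', ''o..pf'', ''eqgpk'', ''rijjk''],
   [''lmmns'', ''lttuu'', ''ootvv'', ''rqqpv'', ''rwwxy''],
   [''zAABs'', ''CCDus'', ''EDDFF'', ''GGHxy'', ''IIwxy''],
   [''zzABB'', ''CJJKK'', ''EEJFK'', ''GLHHM'', ''ILLMM'']]"
  by code_simp

lemma close_picture_222: "depicts 5 [((2, 2, 2), (4, 4, 4))]
  [[''aabbc'', ''daebf'', ''ggeef'', ''ghhii'', ''jjkll''],
   [''mnnoc'', ''d..pc'', ''d..pf'', ''qqhir'', ''jkkls''],
   [''mntoo'', ''m..pu'', ''v..wr'', ''xqywr'', ''xzzss''],
   [''ABtCC'', ''ADtuu'', ''vvEwF'', ''xyyGG'', ''HzIIG''],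
   [''ABBCJ'', ''KDDJJ'', ''KKEEF'', ''HLLMF'', ''HLIMM'']]"
  by code_simp

section \<open>Boxes with a side divisible by three\<close>

lemma translate_box:
  "(+) (u, v, w) ` box (a, b, c) (a', b', c') = box (a + u, b + v, c + w) (a' + u, b' + v, c' + w)"
proof (rule set_eqI)
  fix s :: cell
  obtain x y z where s: "s = (x, y, z)" by (cases s)
  have "s \<in> (+) (u, v, w) ` box (a, b, c) (a', b', c') \<longleftrightarrow> s - (u, v, w) \<in> box (a, b, c) (a', b', c')"
    by (metis (no_types, lifting) add_diff_cancel_left' diff_add_cancel add.commute image_iff)
  then show "s \<in> (+) (u, v, w) ` box (a, b, c) (a', b', c')
      \<longleftrightarrow> s \<in> box (a + u, b + v, c + w) (a' + u, b' + v, c' + w)"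
    by (auto simp: s)
qed

lemma tileable_translate_box:
  "tileable (box (a + u, b + v, c + w) (a' + u, b' + v, c' + w) - (+) (u, v, w) ` S)
     \<longleftrightarrow> tileable (box (a, b, c) (a', b', c') - S)"
proof -
  have "(+) (u, v, w) ` (box (a, b, c) (a', b', c') - S)
      = box (a + u, b + v, c + w) (a' + u, b' + v, c' + w) - (+) (u, v, w) ` S"
    by (simp add: image_set_diff translate_box)
  then show ?thesis using tileable_translate by metis
qed

lemma tileable_cube_3: "tileable (box (a, b, c) (a + 3, b + 3, c + 3))"
  using tileable_picture[OF cube_3_picture]
    tileable_translate_box[of 1 "a - 1" 1 "b - 1" 1 "c - 1" 4 4 4 "{}"]
  by (simp add: algebra_simps)

text \<open>A slice of thickness 3 with an even side consists of 3 by 2 rectangles. If both other sides are odd,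
they are at least 3: cutting off a cube of side 3 and the strip above it leaves only pieces that
have an even side. This is the one place where the tiling of the cube of side 3 is needed.\<close>

lemma tileable_slab_x:
  assumes "3 dvd a' - a" "a \<le> a'" "b + 2 \<le> b'" "c + 2 \<le> c'"
  shows "tileable (box (a, b, c) (a', b', c'))"
proof (rule tileable_stack_x[where d = 3])
  fix m
  show "tileable (box (m, b, c) (m + 3, b', c'))"
  proof (cases "even (b' - b) \<or> even (c' - c)")
    case True
    then show ?thesis using assms by (intro tileable_3_even) auto
  next
    case False
    then have "b' - b \<noteq> 2" "c' - c \<noteq> 2" by (metis even_numeral)+
    then have "b + 3 \<le> b'" "c + 3 \<le> c'" using assms by auto
    have "tileable (box (m, b, c + 3) (m + 3, b + 3, c') - {})"
      using False \<open>c + 3 \<le> c'\<close> tileable_3_even[of "b + 3" b c' "c + 3" m] by simp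
    then have "tileable (box (m, b, c) (m + 3, b + 3, c') - {})"
      by (rule tileable_cut_z[rotated]) (use tileable_cube_3 \<open>c + 3 \<le> c'\<close> in auto)
    moreover have "tileable (box (m, b + 3, c) (m + 3, b', c') - {})"
      using False \<open>b + 3 \<le> b'\<close> assms tileable_3_even[of b' "b + 3" c' c m] by simp
    ultimately have "tileable (box (m, b, c) (m + 3, b', c') - {})"
      by (rule tileable_cut_y) (use \<open>b + 3 \<le> b'\<close> in auto)
    then show ?thesis by simp
  qed
qed (use assms in auto)

lemma tileable_slab_y:
  assumes "3 dvd b' - b" "b \<le> b'" "a + 2 \<le> a'" "c + 2 \<le> c'"
  shows "tileable (box (a, b, c) (a', b', c'))"
  using tileable_slab_x[OF assms] tileable_box_swap_xy by blast

lemma tileable_slab_z: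
  assumes "3 dvd c' - c" "c \<le> c'" "a + 2 \<le> a'" "b + 2 \<le> b'"
  shows "tileable (box (a, b, c) (a', b', c'))"
  using tileable_slab_y[OF assms] tileable_box_swap_yz by blast

text \<open>The induction step modulo 3, for all three axes at once: between a box and a larger box that
sticks out by multiples of 3 on every side lie at most six slabs of thickness divisible by 3, two per
axis. They avoid the removed cells, and their other sides are at least 2.\<close>

lemma tileable_enlarge:
  assumes inner: "tileable (box (a, b, c) (a', b', c') - S)"
    and S: "S \<subseteq> box (a, b, c) (a', b', c')"
    and x: "A \<le> a" "3 dvd a - A" "a + 2 \<le> a'" "a' \<le> A'" "3 dvd A' - a'"
    and y: "B \<le> b" "3 dvd b - B" "b + 2 \<le> b'" "b' \<le> B'" "3 dvd B' - b'"
    and z: "C \<le> c" "3 dvd c - C" "c + 2 \<le> c'" "c' \<le> C'" "3 dvd C' - c'"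
  shows "tileable (box (A, B, C) (A', B', C') - S)"
proof -
  have off: "tileable (box p q - S)"
    if "tileable (box p q)" "box p q \<inter> box (a, b, c) (a', b', c') = {}" for p q
  proof -
    have "box p q - S = box p q" using S that(2) by blast
    then show ?thesis using that(1) by simp
  qed
  have "tileable (box (a', b, c) (A', b', c') - S)"
    by (rule off, rule tileable_slab_x) (use x y z in auto)
  from tileable_cut_x[OF inner this] have 1: "tileable (box (a, b, c) (A', b', c') - S)"
    using x by simp
  have "tileable (box (A, b, c) (a, b', c') - S)"
    by (rule off, rule tileable_slab_x) (use x y z in auto)
  from tileable_cut_x[OF this 1] have 2: "tileable (box (A, b, c) (A', b', c') - S)"
    using x by simp
  have "tileable (box (A, b', c) (A', B', c') - S)"
    by (rule off, rule tileable_slab_y) (use x y z in auto)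
  from tileable_cut_y[OF 2 this] have 3: "tileable (box (A, b, c) (A', B', c') - S)"
    using y by simp
  have "tileable (box (A, B, c) (A', b, c') - S)"
    by (rule off, rule tileable_slab_y) (use x y z in auto)
  from tileable_cut_y[OF this 3] have 4: "tileable (box (A, B, c) (A', B', c') - S)"
    using y by simp
  have "tileable (box (A, B, c') (A', B', C') - S)"
    by (rule off, rule tileable_slab_z) (use x y z in auto)
  from tileable_cut_z[OF 4 this] have 5: "tileable (box (A, B, c) (A', B', C') - S)"
    using z by simp
  have "tileable (box (A, B, C) (A', B', c) - S)"
    by (rule off, rule tileable_slab_z) (use x y z in auto)
  from tileable_cut_z[OF this 5] show ?thesis
    using z by simp
qed

lemma diff_diff_union: "A - B - C = A - (B \<union> C)"
  by blast

text \<open>If a region \<open>H\<close> is flexible, in the sense that it can be tiled after removing any set \<open>S\<close> of a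
certain kind, then one tiling of the complement of \<open>H\<close> serves all those \<open>S\<close> at once. This keeps the
number of explicit tilings small.\<close>

lemma tileable_fill:
  assumes "tileable (R - H)" "tileable (H - S)" "S \<subseteq> H" "H \<subseteq> R"
  shows "tileable (R - S)"
proof -
  have "R - S = (R - H) \<union> (H - S)" using assms(3,4) by blast
  then show ?thesis using tileable_Un[OF assms(1,2)] by (simp add: Int_Diff inf_commute Diff_Int_distrib2)
qed

section \<open>Small deficient boxes\<close>

definition singly_tileable :: "cell \<Rightarrow> cell \<Rightarrow> bool" where
  "singly_tileable p q \<longleftrightarrow> (\<forall>s\<in>box p q. tileable (box p q - {s}))"

lemma singly_tileableD: "singly_tileable p q \<Longrightarrow> in_box p q s \<Longrightarrow> tileable (box p q - {s})"
  by (simp add: singly_tileable_def)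

text \<open>Two removed cells on different sides of a plane reduce the doubly deficient problem to two singly
deficient ones, provided that both parts have volume 1 modulo 3.\<close>

lemma tileable_cut_pair_z:
  assumes "singly_tileable (a, b, c) (a', b', m)" "singly_tileable (a, b, m) (a', b', c')"
    and "c \<le> m" "m \<le> c'"
    and s: "s \<in> box (a, b, c) (a', b', m)" and t: "t \<in> box (a, b, m) (a', b', c')"
  shows "tileable (box (a, b, c) (a', b', c') - {s, t})"
proof (rule tileable_cut_z)
  have "box (a, b, c) (a', b', m) - {s, t} = box (a, b, c) (a', b', m) - {s}"
    using t by auto
  then show "tileable (box (a, b, c) (a', b', m) - {s, t})"
    using assms(1) s by (simp add: singly_tileable_def)
  have "box (a, b, m) (a', b', c') - {s, t} = box (a, b, m) (a', b', c') - {t}"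
    using s by auto
  then show "tileable (box (a, b, m) (a', b', c') - {s, t})"
    using assms(2) t by (simp add: singly_tileable_def)
qed (use assms in auto)

lemma singly_tileable_translate:
  assumes "singly_tileable (a, b, c) (a', b', c')"
  shows "singly_tileable (a + u, b + v, c + w) (a' + u, b' + v, c' + w)"
  unfolding singly_tileable_def
proof
  fix s assume s: "s \<in> box (a + u, b + v, c + w) (a' + u, b' + v, c' + w)"
  obtain x y z where [simp]: "s = (x, y, z)" by (cases s)
  have "tileable (box (a, b, c) (a', b', c') - {(x - u, y - v, z - w)})"
    using assms s by (intro singly_tileableD) auto
  then show "tileable (box (a + u, b + v, c + w) (a' + u, b' + v, c' + w) - {s})"
    using tileable_translate_box[of a u b v c w a' b' c' "{(x - u, y - v, z - w)}"] by simp
qed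

lemma singly_tileable_square: "singly_tileable (a, b, c) (a + 2, b + 2, c + 1)"
  unfolding singly_tileable_def
proof
  fix s assume "s \<in> box (a, b, c) (a + 2, b + 2, c + 1)"
  then obtain x y where s: "s = (x, y, c)" and xy: "x = a \<or> x = a + 1" "y = b \<or> y = b + 1"
    by (cases s) force
  \<comment> \<open>The reflection of the removed cell in the centre of the square is the corner of the tromino.\<close>
  define x' y' where "x' = 2 * a + 1 - x" and "y' = 2 * b + 1 - y"
  have "box (a, b, c) (a + 2, b + 2, c + 1) = {x, x'} \<times> {y, y'} \<times> {c}"
    using xy by (auto simp: x'_def y'_def)
  then have "box (a, b, c) (a + 2, b + 2, c + 1) - {s} = {(x', y', c), (x, y', c), (x', y, c)}"
    using xy by (auto simp: s x'_def y'_def)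
  moreover have "bent (x', y', c) (x, y', c) (x', y, c)"
    using xy by (auto simp: bent_def x'_def y'_def)
  ultimately show "tileable (box (a, b, c) (a + 2, b + 2, c + 1) - {s})"
    using tileable_tromino by simp
qed

text \<open>Two distinct cells differ in some coordinate. The plane halving the cube along that axis separates
them, and each half is a 2 by 2 square without one cell, which is a tromino.\<close>

lemma tileable_cube_2:
  assumes "in_box (a, b, c) (a + 2, b + 2, c + 2) s" "in_box (a, b, c) (a + 2, b + 2, c + 2) t" "s \<noteq> t"
  shows "tileable (box (a, b, c) (a + 2, b + 2, c + 2) - {s, t})"
proof -
  have cut: "tileable (box (a, b, c) (a + 2, b + 2, c + 2) - {(x, y, z), (x', y', z')})"
    if "z < z'" "in_box (a, b, c) (a + 2, b + 2, c + 2) (x, y, z)"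
      "in_box (a, b, c) (a + 2, b + 2, c + 2) (x', y', z')" for a b c x y z x' y' z'
  proof (rule tileable_cut_pair_z[where m = "c + 1"])
    show "singly_tileable (a, b, c + 1) (a + 2, b + 2, c + 2)"
      using singly_tileable_square[of a b "c + 1"] by (simp add: add.assoc)
  qed (use that in \<open>auto intro: singly_tileable_square\<close>)
  have z: "tileable (box (a, b, c) (a + 2, b + 2, c + 2) - {(x, y, z), (x', y', z')})"
    if "z \<noteq> z'" "in_box (a, b, c) (a + 2, b + 2, c + 2) (x, y, z)"
      "in_box (a, b, c) (a + 2, b + 2, c + 2) (x', y', z')" for a b c x y z x' y' z'
    using cut[of z z' a b c x y x' y'] cut[of z' z a b c x' y' x y] that
      insert_commute[of "(x, y, z)" "(x', y', z')" "{}"]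
    by (cases "z < z'") auto
  have y: "tileable (box (a, b, c) (a + 2, b + 2, c + 2) - {(x, y, z), (x', y', z')})"
    if "y \<noteq> y'" "in_box (a, b, c) (a + 2, b + 2, c + 2) (x, y, z)"
      "in_box (a, b, c) (a + 2, b + 2, c + 2) (x', y', z')" for a b c x y z x' y' z'
    using z[of y y' a c b x z x' z'] that
      tileable_diff_swap_yz[of a b c "a + 2" "b + 2" "c + 2" "{(x, y, z), (x', y', z')}"] by auto
  have x: "tileable (box (a, b, c) (a + 2, b + 2, c + 2) - {(x, y, z), (x', y', z')})"
    if "x \<noteq> x'" "in_box (a, b, c) (a + 2, b + 2, c + 2) (x, y, z)"
      "in_box (a, b, c) (a + 2, b + 2, c + 2) (x', y', z')" for a b c x y z x' y' z'
    using y[of x x' b a c y z y' z'] that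
      tileable_diff_swap_xy[of a b c "a + 2" "b + 2" "c + 2" "{(x, y, z), (x', y', z')}"] by auto
  obtain x1 y1 z1 x2 y2 z2 where st: "s = (x1, y1, z1)" "t = (x2, y2, z2)"
    by (cases s; cases t)
  then consider "x1 \<noteq> x2" | "y1 \<noteq> y2" | "z1 \<noteq> z2" using assms(3) by blast
  then show ?thesis
    using x y z assms(1,2) unfolding st by cases blast+
qed

text \<open>By reflection the removed cell may be taken in the octant at the origin. The picture tiles everything
except seven cells of that octant, and an octant without any two of its cells is tileable; so the
picture serves seven positions. The eighth, \<open>(1, 1, 2)\<close>, is a transpose of \<open>(1, 2, 1)\<close>.\<close>

lemma singly_tileable_cube_4: "singly_tileable (a, b, c) (a + 4, b + 4, c + 4)"
proof -
  let ?C = "box (1, 1, 1) (5, 5, 5)"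
  let ?H = "box (1, 1, 1) (3, 3, 3) - {(1, 1, 2)}"
  have picture: "tileable (?C - ?H)"
  proof -
    have "?C - ?H = ?C - (box (1, 1, 1) (3, 3, 2) \<union> box (2, 1, 2) (3, 3, 3) \<union> box (1, 2, 2) (2, 3, 3))"
      by auto
    then show ?thesis using tileable_picture[OF cube_4_picture] by (simp add: Un_assoc)
  qed
  have 1: "tileable (?C - {s})" if "in_box (1, 1, 1) (3, 3, 3) s" "s \<noteq> (1, 1, 2)" for s
  proof (rule tileable_fill[OF picture])
    have "?H - {s} = box (1, 1, 1) (3, 3, 3) - {(1, 1, 2), s}" by blast
    then show "tileable (?H - {s})"
      using tileable_cube_2[of 1 1 1 "(1, 1, 2)" s] that by simp
    show "{s} \<subseteq> ?H" using that by simp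
    show "?H \<subseteq> ?C" by auto
  qed
  have octant: "tileable (?C - {(x, y, z)})" if "in_box (1, 1, 1) (3, 3, 3) (x, y, z)" for x y z
  proof (cases "(x, y, z) = (1, 1, 2)")
    case True
    have "tileable (?C - {(1, 2, 1)})" by (rule 1) auto
    then show ?thesis
      using True tileable_diff_swap_yz[of 1 1 1 5 5 5 "{(1, 2, 1)}"] by simp
  next
    case False
    then show ?thesis using 1 that by blast
  qed
  have x: "tileable (?C - {(x, y, z)})" if "in_box (1, 1, 1) (5, 3, 3) (x, y, z)" for x y z
    using octant[of x y z] octant[of "5 - x" y z] that
      tileable_diff_mirror_x[of 1 1 1 5 5 5 "{(x, y, z)}" 5] by (cases "x < 3") auto
  have y: "tileable (?C - {(x, y, z)})" if "in_box (1, 1, 1) (5, 5, 3) (x, y, z)" for x y z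
    using x[of x y z] x[of x "5 - y" z] that
      tileable_diff_mirror_y[of 1 1 1 5 5 5 "{(x, y, z)}" 5] by (cases "y < 3") auto
  have z: "tileable (?C - {(x, y, z)})" if "in_box (1, 1, 1) (5, 5, 5) (x, y, z)" for x y z
    using y[of x y z] y[of x y "5 - z"] that
      tileable_diff_mirror_z[of 1 1 1 5 5 5 "{(x, y, z)}" 5] by (cases "z < 3") auto
  have "singly_tileable (1, 1, 1) (5, 5, 5)"
    unfolding singly_tileable_def using z by auto
  then show ?thesis
    using singly_tileable_translate[of 1 1 1 5 5 5 "a - 1" "b - 1" "c - 1"] by (simp add: algebra_simps)
qed

text \<open>By reflection the removed cell lies in a cube of side 4 at one edge of the box. Unfolding what
remains gives a 9 by 4 rectangle with a crease along its fifth row. The three rows at the crease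
become a stack of four trominoes, and the two flat ends are 3 by 4 rectangles.\<close>

lemma singly_tileable_5_5_4: "singly_tileable (a, b, c) (a + 5, b + 5, c + 4)"
proof -
  let ?B = "box (1, 1, 1) (6, 6, 5)" and ?C = "box (1, 1, 1) (5, 5, 5)"
  \<comment> \<open>The bent part of the shell, sliced into trominoes.\<close>
  define corner :: "int \<Rightarrow> cell set" where "corner z = {(5, 5, z), (4, 5, z), (5, 4, z)}" for z
  have "tileable (\<Union>z\<in>{1..4}. corner z)"
    by (rule tileable_Union) (auto simp: corner_def disjoint_family_on_def bent_def intro!: tileable_tromino)
  moreover have "tileable (box (1, 5, 1) (4, 6, 5))"
    using tileable_3_even[of 6 5 5 1 1] by simp
  moreover have "tileable (box (5, 1, 1) (6, 4, 5))"
    using tileable_3_even[of 6 5 5 1 1] tileable_box_swap_xy[of 1 5 1] by simp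
  ultimately have "tileable (((\<Union>z\<in>{1..4}. corner z) \<union> box (1, 5, 1) (4, 6, 5)) \<union> box (5, 1, 1) (6, 4, 5))"
    by (intro tileable_Un) (auto simp: corner_def)
  also have "((\<Union>z\<in>{1..4}. corner z) \<union> box (1, 5, 1) (4, 6, 5)) \<union> box (5, 1, 1) (6, 4, 5) = ?B - ?C"
  proof (rule set_eqI)
    fix s :: cell
    obtain x y z where s: "s = (x, y, z)" by (cases s)
    have "s \<in> (\<Union>z\<in>{1..4}. corner z)
        \<longleftrightarrow> (x = 5 \<and> y = 5 \<or> x = 4 \<and> y = 5 \<or> x = 5 \<and> y = 4) \<and> 1 \<le> z \<and> z \<le> 4"
      by (auto simp: s corner_def)
    then show "s \<in> ((\<Union>z\<in>{1..4}. corner z) \<union> box (1, 5, 1) (4, 6, 5)) \<union> box (5, 1, 1) (6, 4, 5)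
        \<longleftrightarrow> s \<in> ?B - ?C"
      unfolding Un_iff Diff_iff s mem_box in_box.simps by (smt (verit))
  qed
  finally have shell: "tileable (?B - ?C)" .
  have C: "tileable (?B - {s})" if "in_box (1, 1, 1) (5, 5, 5) s" for s
  proof (rule tileable_fill[OF shell])
    show "tileable (?C - {s})"
      using singly_tileable_cube_4[of 1 1 1] that by (simp add: singly_tileableD)
  qed (use that in auto)
  have x: "tileable (?B - {(x, y, z)})" if "in_box (1, 1, 1) (6, 5, 5) (x, y, z)" for x y z
    using C[of "(x, y, z)"] C[of "(6 - x, y, z)"] that
      tileable_diff_mirror_x[of 1 1 1 6 6 5 "{(x, y, z)}" 6] by (cases "x = 5") auto
  have y: "tileable (?B - {(x, y, z)})" if "in_box (1, 1, 1) (6, 6, 5) (x, y, z)" for x y z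
    using x[of x y z] x[of x "6 - y" z] that
      tileable_diff_mirror_y[of 1 1 1 6 6 5 "{(x, y, z)}" 6] by (cases "y = 5") auto
  have "singly_tileable (1, 1, 1) (6, 6, 5)"
    unfolding singly_tileable_def using y by auto
  then show ?thesis
    using singly_tileable_translate[of 1 1 1 6 6 5 "a - 1" "b - 1" "c - 1"] by (simp add: algebra_simps)
qed

section \<open>The doubly deficient cube of side five\<close>

text \<open>The symmetries of the cube of side 5 act on pairs of removed cells; a predicate of pairs lets the case
distinction use them directly.\<close>

definition tileable_without :: "cell \<Rightarrow> cell \<Rightarrow> bool" where
  "tileable_without s t \<longleftrightarrow> tileable (box (1, 1, 1) (6, 6, 6) - {s, t})"

lemma tileable_without_commute: "tileable_without s t \<longleftrightarrow> tileable_without t s"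
  by (simp add: tileable_without_def insert_commute[of s t])

lemma tileable_without_symmetries:
  "tileable_without (x, y, z) (x', y', z') \<longleftrightarrow> tileable_without (y, x, z) (y', x', z')"
  "tileable_without (x, y, z) (x', y', z') \<longleftrightarrow> tileable_without (x, z, y) (x', z', y')"
  "tileable_without (x, y, z) (x', y', z') \<longleftrightarrow> tileable_without (6 - x, y, z) (6 - x', y', z')"
  "tileable_without (x, y, z) (x', y', z') \<longleftrightarrow> tileable_without (x, 6 - y, z) (x', 6 - y', z')"
  "tileable_without (x, y, z) (x', y', z') \<longleftrightarrow> tileable_without (x, y, 6 - z) (x', y', 6 - z')"
  using tileable_diff_swap_xy[of 1 1 1 6 6 6 "{(x, y, z), (x', y', z')}"]
    tileable_diff_swap_yz[of 1 1 1 6 6 6 "{(x, y, z), (x', y', z')}"]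
    tileable_diff_mirror_x[of 1 1 1 6 6 6 "{(x, y, z), (x', y', z')}" 6]
    tileable_diff_mirror_y[of 1 1 1 6 6 6 "{(x, y, z), (x', y', z')}" 6]
    tileable_diff_mirror_z[of 1 1 1 6 6 6 "{(x, y, z), (x', y', z')}" 6]
  unfolding tileable_without_def by simp_all

lemma singly_tileable_swap_xy:
  assumes "singly_tileable (a, b, c) (a', b', c')"
  shows "singly_tileable (b, a, c) (b', a', c')"
  unfolding singly_tileable_def
proof
  fix s assume s: "s \<in> box (b, a, c) (b', a', c')"
  obtain x y z where [simp]: "s = (x, y, z)" by (cases s)
  have "tileable (box (a, b, c) (a', b', c') - {(y, x, z)})"
    using assms s by (intro singly_tileableD) auto
  then show "tileable (box (b, a, c) (b', a', c') - {s})"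
    using tileable_diff_swap_xy[of a b c a' b' c' "{(y, x, z)}"] by simp
qed

lemma singly_tileable_swap_yz:
  assumes "singly_tileable (a, b, c) (a', b', c')"
  shows "singly_tileable (a, c, b) (a', c', b')"
  unfolding singly_tileable_def
proof
  fix s assume s: "s \<in> box (a, c, b) (a', c', b')"
  obtain x y z where [simp]: "s = (x, y, z)" by (cases s)
  have "tileable (box (a, b, c) (a', b', c') - {(x, z, y)})"
    using assms s by (intro singly_tileableD) auto
  then show "tileable (box (a, c, b) (a', c', b') - {s})"
    using tileable_diff_swap_yz[of a b c a' b' c' "{(x, z, y)}"] by simp
qed

lemma singly_tileable_yz_square: "singly_tileable (a, b, c) (a + 1, b + 2, c + 2)"
  using singly_tileable_swap_xy[OF singly_tileable_swap_yz[OF singly_tileable_square]] .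

text \<open>The shell consists of three faces of the cube meeting at a corner, so that it has 61 cells. In each
picture of the shell the region left blank, a 2 by 2 square or a 2 by 2 by 2 block without its innermost cell,
can be completed whichever of its cells is removed. Up to exchange of the second and third coordinate
six pictures reach every cell of the face.\<close>

lemma shell_minus_cell:
  assumes "in_box (1, 1, 1) (2, 6, 6) (1, a, b)"
  shows "tileable (box (1, 1, 1) (6, 6, 6) - box (2, 2, 2) (6, 6, 6) - {(1, a, b)})"
proof -
  let ?R = "box (1, 1, 1) (6, 6, 6) - box (2, 2, 2) (6, 6, 6)"
  have square: "tileable (?R - {(1, a, b)})"
    if pic: "depicts 5 [((2, 2, 2), (6, 6, 6)), ((1, i, j), (2, i + 2, j + 2))] pic"
      and ij: "1 \<le> i" "i \<le> a" "a < i + 2" "i \<le> 4" "1 \<le> j" "j \<le> b" "b < j + 2" "j \<le> 4" for a b i j pic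
  proof (rule tileable_fill)
    show "tileable (?R - box (1, i, j) (2, i + 2, j + 2))"
      using tileable_picture[OF pic] by (simp add: diff_diff_union)
    show "tileable (box (1, i, j) (2, i + 2, j + 2) - {(1, a, b)})"
      using singly_tileable_yz_square[of 1 i j] ij by (intro singly_tileableD) auto
  qed (use ij in auto)
  have corner: "tileable (?R - {(1, a, b)})" if ab: "1 \<le> a" "a \<le> 2" "1 \<le> b" "b \<le> 2" for a b
  proof (rule tileable_fill)
    let ?H = "box (1, 1, 1) (3, 3, 3) - {(2, 2, 2)}"
    have "?R - ?H = box (1, 1, 1) (6, 6, 6) - (box (2, 2, 2) (6, 6, 6) \<union> box (1, 1, 1) (3, 3, 3))"
      by auto
    then show "tileable (?R - ?H)"
      using tileable_picture[OF shell_picture_11] by simp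
    have "?H - {(1, a, b)} = box (1, 1, 1) (3, 3, 3) - {(2, 2, 2), (1, a, b)}" by blast
    then show "tileable (?H - {(1, a, b)})"
      using tileable_cube_2[of 1 1 1 "(2, 2, 2)" "(1, a, b)"] ab by simp
    show "{(1, a, b)} \<subseteq> ?H" using ab by simp
    show "?H \<subseteq> ?R" by auto
  qed
  have sorted: "tileable (?R - {(1, a, b)})" if ab: "1 \<le> a" "a \<le> b" "b \<le> 5" for a b
  proof -
    consider "a \<le> 2" "b \<le> 2" | "a \<le> 2" "3 \<le> b" "b \<le> 4" | "a \<le> 2" "b = 5"
      | "3 \<le> a" "b \<le> 4" | "a = 3" "b = 5" | "4 \<le> a" "b = 5"
      using ab by linarith
    then show ?thesis
    proof cases
      case 1 then show ?thesis using corner ab by simp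
    next
      case 2 then show ?thesis using square[of 1 3 _ a b] shell_picture_13 ab by simp
    next
      case 3 then show ?thesis using square[of 1 4 _ a b] shell_picture_14 ab by simp
    next
      case 4 then show ?thesis using square[of 3 3 _ a b] shell_picture_33 ab by simp
    next
      case 5 then show ?thesis using square[of 2 4 _ a b] shell_picture_24 ab by simp
    next
      case 6 then show ?thesis using square[of 4 4 _ a b] shell_picture_44 ab by simp
    qed
  qed
  show ?thesis
  proof (cases "a \<le> b")
    case True
    then show ?thesis using sorted assms by simp
  next
    case False
    then have "tileable (?R - {(1, b, a)})" using sorted assms by simp
    then have "tileable (box (1, 1, 1) (6, 6, 6) - (box (2, 2, 2) (6, 6, 6) \<union> {(1, b, a)}))"
      by (simp add: diff_diff_union)
    then show ?thesis
      using tileable_diff_swap_yz[of 1 1 1 6 6 6 "box (2, 2, 2) (6, 6, 6) \<union> {(1, b, a)}"]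
      by (simp add: diff_diff_union image_Un image_box)
  qed
qed

text \<open>One removed cell lies on a face of the cube and the other does not. Then a corner of that face
can be chosen such that the cube of side 4 at the opposite corner contains the second
cell; the first cell lies in the complementary shell. The shell and the smaller cube are tiled
separately.\<close>

lemma tileable_without_face:
  assumes "in_box (1, 1, 1) (6, 6, 6) (x, y, z)" "in_box (1, 1, 1) (6, 6, 6) (x', y', z')"
    and "x = 1 \<or> x = 5" "x \<noteq> x'"
  shows "tileable_without (x, y, z) (x', y', z')"
proof -
  have 1: "tileable_without (1, a, b) (x', y', z')"
    if ab: "1 \<le> a" "a \<le> 5" "1 \<le> b" "b \<le> 5" and "in_box (2, 2, 2) (6, 6, 6) (x', y', z')" for a b x' y' z'
  proof -
    let ?C = "box (1, 1, 1) (6, 6, 6)" and ?B = "box (2, 2, 2) (6, 6, 6)"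
    have "tileable ((?C - {(1, a, b)}) - {(x', y', z')})"
    proof (rule tileable_fill)
      have "?C - {(1, a, b)} - ?B = ?C - ?B - {(1, a, b)}" by blast
      then show "tileable (?C - {(1, a, b)} - ?B)"
        using shell_minus_cell[of a b] ab by simp
      show "tileable (?B - {(x', y', z')})"
        using singly_tileable_cube_4[of 2 2 2] that by (simp add: singly_tileableD)
    qed (use that in auto)
    moreover have "?C - {(1, a, b)} - {(x', y', z')} = ?C - {(1, a, b), (x', y', z')}" by blast
    ultimately show ?thesis by (simp add: tileable_without_def)
  qed
  have 2: "tileable_without (1, a, b) (x', y', z')"
    if "1 \<le> a" "a \<le> 5" "1 \<le> b" "b \<le> 5" "in_box (2, 1, 2) (6, 6, 6) (x', y', z')" for a b x' y' z'
  proof (cases "y' = 1")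
    case True
    then have "tileable_without (1, 6 - a, b) (x', 6 - y', z')" using that by (intro 1) auto
    then show ?thesis using tileable_without_symmetries(4) by blast
  next
    case False
    then show ?thesis using that by (intro 1) auto
  qed
  have 3: "tileable_without (1, a, b) (x', y', z')"
    if "1 \<le> a" "a \<le> 5" "1 \<le> b" "b \<le> 5" "in_box (2, 1, 1) (6, 6, 6) (x', y', z')" for a b x' y' z'
  proof (cases "z' = 1")
    case True
    then have "tileable_without (1, a, 6 - b) (x', y', 6 - z')" using that by (intro 2) auto
    then show ?thesis using tileable_without_symmetries(5) by blast
  next
    case False
    then show ?thesis using that by (intro 2) auto
  qed
  show ?thesis
  proof (cases "x = 1")
    case True
    then show ?thesis using assms by (auto intro!: 3)
  next
    case False
    then have "tileable_without (6 - x, y, z) (6 - x', y', z')"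
      using assms by (auto intro!: 3)
    then show ?thesis using tileable_without_symmetries(3) by blast
  qed
qed

text \<open>Permuting and reflecting coordinates moves the block to one of four positions. The one at the corner
is a case of adding slabs; the other three have pictures.\<close>

lemma tileable_minus_block:
  assumes "1 \<le> i" "i \<le> 4" "1 \<le> j" "j \<le> 4" "1 \<le> k" "k \<le> 4"
  shows "tileable (box (1, 1, 1) (6, 6, 6) - box (i, j, k) (i + 2, j + 2, k + 2))"
proof -
  define ok where "ok i j k \<longleftrightarrow> tileable (box (1, 1, 1) (6, 6, 6) - box (i, j, k) (i + 2, j + 2, k + 2))"
    for i j k :: int
  have swap: "ok i j k \<longleftrightarrow> ok j i k" "ok i j k \<longleftrightarrow> ok i k j" for i j k
    unfolding ok_def
    using tileable_diff_swap_xy[of 1 1 1 6 6 6 "box (i, j, k) (i + 2, j + 2, k + 2)"]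
      tileable_diff_swap_yz[of 1 1 1 6 6 6 "box (i, j, k) (i + 2, j + 2, k + 2)"]
    by (simp_all add: image_box)
  have mirror: "ok i j k \<longleftrightarrow> ok (5 - i) j k" for i j k
    unfolding ok_def
    using tileable_diff_mirror_x[of 1 1 1 6 6 6 "box (i, j, k) (i + 2, j + 2, k + 2)" 6]
    by (simp add: image_box)
  have "tileable (box (1, 1, 1) (6, 6, 6) - box (1, 1, 1) (3, 3, 3))"
    by (rule tileable_enlarge[of 1 1 1 3 3 3]) (auto simp: tileable_empty)
  then have "ok 1 1 1" by (simp add: ok_def)
  moreover have "ok 1 1 2"
    using tileable_picture[OF close_picture_112] by (simp add: ok_def)
  moreover have "ok 1 2 2"
    using tileable_picture[OF close_picture_122] by (simp add: ok_def)
  moreover have "ok 2 2 2"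
    using tileable_picture[OF close_picture_222] by (simp add: ok_def)
  ultimately have sorted_or_not: "ok i j k" if "i = 1 \<or> i = 2" "j = 1 \<or> j = 2" "k = 1 \<or> k = 2" for i j k
    using that swap by metis
  have low: "ok i j k" if "1 \<le> i" "i \<le> 2" "1 \<le> j" "j \<le> 2" "1 \<le> k" "k \<le> 2" for i j k
    by (rule sorted_or_not) (use that in auto)
  have x: "ok i j k" if "1 \<le> i" "i \<le> 4" "1 \<le> j" "j \<le> 2" "1 \<le> k" "k \<le> 2" for i j k
  proof (cases "i \<le> 2")
    case True
    then show ?thesis using that by (intro low)
  next
    case False
    then have "ok (5 - i) j k" using that by (intro low) auto
    then show ?thesis using mirror by blast
  qed
  have y: "ok i j k" if "1 \<le> i" "i \<le> 4" "1 \<le> j" "j \<le> 4" "1 \<le> k" "k \<le> 2" for i j k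
  proof (cases "j \<le> 2")
    case True
    then show ?thesis using that by (intro x)
  next
    case False
    then have "ok i (5 - j) k" using that by (intro x) auto
    then show ?thesis using mirror swap by blast
  qed
  have "ok i j k"
  proof (cases "k \<le> 2")
    case True
    then show ?thesis using assms by (intro y)
  next
    case False
    then have "ok i j (5 - k)" using assms by (intro y) auto
    then have "ok (5 - k) i j" using swap by blast
    then have "ok k i j" using mirror by blast
    then show ?thesis using swap by blast
  qed
  then show ?thesis by (simp add: ok_def)
qed

text \<open>Cells whose coordinates all differ by at most 1 lie in a common 2 by 2 by 2 block, and such a block
can be tiled without any two of its cells.\<close>

lemma tileable_without_close:
  assumes "in_box (1, 1, 1) (6, 6, 6) (x, y, z)" "in_box (1, 1, 1) (6, 6, 6) (x', y', z')"
    and "\<bar>x - x'\<bar> \<le> 1" "\<bar>y - y'\<bar> \<le> 1" "\<bar>z - z'\<bar> \<le> 1" "(x, y, z) \<noteq> (x', y', z')"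
  shows "tileable_without (x, y, z) (x', y', z')"
proof -
  have corner: "\<exists>i. 1 \<le> i \<and> i \<le> 4 \<and> i \<le> u \<and> u < i + 2 \<and> i \<le> v \<and> v < i + 2"
    if "1 \<le> u" "u < 6" "1 \<le> v" "v < 6" "\<bar>u - v\<bar> \<le> 1" for u v :: int
    using that by (intro exI[of _ "min (min u v) 4"]) auto
  obtain i j k where
    i: "1 \<le> i \<and> i \<le> 4 \<and> i \<le> x \<and> x < i + 2 \<and> i \<le> x' \<and> x' < i + 2" and
    j: "1 \<le> j \<and> j \<le> 4 \<and> j \<le> y \<and> y < j + 2 \<and> j \<le> y' \<and> y' < j + 2" and
    k: "1 \<le> k \<and> k \<le> 4 \<and> k \<le> z \<and> z < k + 2 \<and> k \<le> z' \<and> z' < k + 2"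
    using corner[of x x'] corner[of y y'] corner[of z z'] assms by auto
  show ?thesis
    unfolding tileable_without_def
  proof (rule tileable_fill)
    show "tileable (box (1, 1, 1) (6, 6, 6) - box (i, j, k) (i + 2, j + 2, k + 2))"
      using i j k by (intro tileable_minus_block) auto
    show "tileable (box (i, j, k) (i + 2, j + 2, k + 2) - {(x, y, z), (x', y', z')})"
      using i j k assms by (intro tileable_cube_2) auto
  qed (use i j k in auto)
qed

text \<open>These are the pairs of coordinates on an axis to which the face argument does not apply: whenever
one of them is extreme (1 or 5), the other is equal to it.\<close>

definition locked :: "int \<Rightarrow> int \<Rightarrow> bool" where
  "locked u v \<longleftrightarrow> u = v \<or> u \<in> {2, 3, 4} \<and> v \<in> {2, 3, 4}"

text \<open>Each removed cell is the hole in a 2 by 2 square, one in the layer at height 2, the other in the layer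
at height 4. Up to reflection, any locked pair of coordinates fits one of two relative
positions of the squares along an axis, namely both at \<open>{1, 2}\<close>, or at \<open>{2, 3}\<close> and \<open>{3, 4}\<close>. As
the two axes can be exchanged, three pictures remain.\<close>

lemma tileable_without_far:
  assumes "locked x x'" "locked y y'" "x \<in> {1..5}" "y \<in> {1..5}"
  shows "tileable_without (x, y, 2) (x', y', 4)"
proof -
  let ?C = "box (1, 1, 1) (6, 6, 6)"
  have squares: "tileable_without (x, y, 2) (x', y', 4)"
    if pic: "depicts 5 [((i, j, 2), (i + 2, j + 2, 3)), ((i', j', 4), (i' + 2, j' + 2, 5))] pic"
      and "1 \<le> i" "i \<le> 4" "1 \<le> i'" "i' \<le> 4" "1 \<le> j" "j \<le> 4" "1 \<le> j'" "j' \<le> 4"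
        "i \<le> x" "x < i + 2" "i' \<le> x'" "x' < i' + 2" "j \<le> y" "y < j + 2" "j' \<le> y'" "y' < j' + 2"
    for x y x' y' i j i' j' pic
  proof -
    let ?H = "box (i, j, 2) (i + 2, j + 2, 3)" and ?H' = "box (i', j', 4) (i' + 2, j' + 2, 5)"
    have sq: "tileable (?H - {(x, y, 2)})" "tileable (?H' - {(x', y', 4)})"
      using singly_tileableD[OF singly_tileable_square[of i j 2], of "(x, y, 2)"]
        singly_tileableD[OF singly_tileable_square[of i' j' 4], of "(x', y', 4)"] that(2-)
      by simp_all
    have "?H \<union> ?H' - {(x, y, 2), (x', y', 4)} = (?H - {(x, y, 2)}) \<union> (?H' - {(x', y', 4)})"
      by auto
    moreover have "(?H - {(x, y, 2)}) \<inter> (?H' - {(x', y', 4)}) = {}"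
      by auto
    ultimately have holes: "tileable (?H \<union> ?H' - {(x, y, 2), (x', y', 4)})"
      using tileable_Un[OF sq] by simp
    have "tileable (?C - (?H \<union> ?H'))"
      using tileable_picture[OF pic] by simp
    then show ?thesis
      unfolding tileable_without_def using holes by (rule tileable_fill) (use that in auto)
  qed
  \<comment> \<open>The two relative positions of the squares along an axis.\<close>
  define near :: "int \<Rightarrow> int \<Rightarrow> bool" where "near u v \<longleftrightarrow> u \<in> {1, 2} \<and> v \<in> {1, 2}" for u v
  define apart :: "int \<Rightarrow> int \<Rightarrow> bool" where "apart u v \<longleftrightarrow> u \<in> {2, 3} \<and> v \<in> {3, 4}" for u v
  have base: "tileable_without (x, y, 2) (x', y', 4)"
    if "near x x' \<or> apart x x'" "near y y' \<or> apart y y'" for x y x' y'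
  proof -
    have nn: ?thesis if "near x x'" "near y y'"
      using squares[of 1 1 1 1] far_picture_11 that by (auto simp: near_def)
    have na: "tileable_without (x, y, 2) (x', y', 4)" if "near x x'" "apart y y'" for x y x' y'
      using squares[of 1 2 1 3] far_picture_12 that by (auto simp: near_def apart_def)
    have aa: ?thesis if "apart x x'" "apart y y'"
      using squares[of 2 2 3 3] far_picture_22 that by (auto simp: apart_def)
    show ?thesis
      using nn na aa that tileable_without_symmetries(1)[of x y 2 x' y' 4] by blast
  qed
  have fold: "(near u v \<or> apart u v) \<or> (near (6 - u) (6 - v) \<or> apart (6 - u) (6 - v))"
    if "locked u v" "u \<in> {1..5}" for u v
    using that by (auto simp: locked_def near_def apart_def)
  have "tileable_without (x, y, 2) (x', y', 4)" if "near x x' \<or> apart x x'" for x x'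
    using base[OF that] fold[OF assms(2,4)] tileable_without_symmetries(4)[of x y 2 x' y' 4] by blast
  then show ?thesis
    using fold[OF assms(1,3)] tileable_without_symmetries(3)[of x y 2 x' y' 4] by blast
qed

text \<open>If some axis is not locked, the face argument applies. Otherwise the cells are close, or on some
axis they are at distance at least 2; being locked there, those coordinates are 2 and 4.\<close>

lemma doubly_deficient_cube_5:
  assumes "in_box (1, 1, 1) (6, 6, 6) s" "in_box (1, 1, 1) (6, 6, 6) t" "s \<noteq> t"
  shows "tileable (box (1, 1, 1) (6, 6, 6) - {s, t})"
proof -
  have face: "tileable_without (x, y, z) (x', y', z')"
    if "in_box (1, 1, 1) (6, 6, 6) (x, y, z)" "in_box (1, 1, 1) (6, 6, 6) (x', y', z')"
      "\<not> locked x x'" for x y z x' y' z'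
  proof (cases "x = 1 \<or> x = 5")
    case True
    then show ?thesis using that by (intro tileable_without_face) (auto simp: locked_def)
  next
    case False
    then have "tileable_without (x', y', z') (x, y, z)"
      using that by (intro tileable_without_face) (auto simp: locked_def)
    then show ?thesis using tileable_without_commute by blast
  qed
  have far: "tileable_without (x, y, z) (x', y', z')"
    if "in_box (1, 1, 1) (6, 6, 6) (x, y, z)" "in_box (1, 1, 1) (6, 6, 6) (x', y', z')"
      and locked: "locked x x'" "locked y y'" "locked z z'" "\<not> \<bar>z - z'\<bar> \<le> 1" for x y z x' y' z'
  proof -
    consider "z = 2" "z' = 4" | "z = 4" "z' = 2"
      using locked(3,4) by (auto simp: locked_def)
    then show ?thesis
    proof cases
      case 1
      then show ?thesis using that by (auto intro: tileable_without_far)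
    next
      case 2
      then have "tileable_without (x', y', z') (x, y, z)"
        using that by (auto intro!: tileable_without_far simp: locked_def)
      then show ?thesis using tileable_without_commute by blast
    qed
  qed
  obtain x y z x' y' z' where st: "s = (x, y, z)" "t = (x', y', z')"
    by (cases s; cases t)
  note sym = tileable_without_symmetries(1)[of x y z x' y' z']
    tileable_without_symmetries(2)[of x y z x' y' z'] tileable_without_symmetries(1)[of x z y x' z' y']
  have in_boxes: "in_box (1, 1, 1) (6, 6, 6) (x, y, z)" "in_box (1, 1, 1) (6, 6, 6) (x', y', z')"
    using assms by (simp_all add: st)
  consider "\<not> locked x x'" | "\<not> locked y y'" | "\<not> locked z z'"
    | "locked x x'" "locked y y'" "locked z z'" "\<not> \<bar>x - x'\<bar> \<le> 1"
    | "locked x x'" "locked y y'" "locked z z'" "\<not> \<bar>y - y'\<bar> \<le> 1"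
    | "locked x x'" "locked y y'" "locked z z'" "\<not> \<bar>z - z'\<bar> \<le> 1"
    | "\<bar>x - x'\<bar> \<le> 1" "\<bar>y - y'\<bar> \<le> 1" "\<bar>z - z'\<bar> \<le> 1"
    by blast
  then have "tileable_without (x, y, z) (x', y', z')"
  proof cases
    case 1
    then show ?thesis using in_boxes by (intro face)
  next
    case 2
    then have "tileable_without (y, x, z) (y', x', z')" using in_boxes by (intro face) auto
    then show ?thesis using sym by blast
  next
    case 3
    then have "tileable_without (z, x, y) (z', x', y')" using in_boxes by (intro face) auto
    then show ?thesis using sym by blast
  next
    case 4
    then have "tileable_without (y, z, x) (y', z', x')" using in_boxes by (intro far) auto
    then show ?thesis
      using tileable_without_symmetries(2)[of y z x y' z' x'] sym by blast
  next
    case 5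
    then have "tileable_without (x, z, y) (x', z', y')" using in_boxes by (intro far) auto
    then show ?thesis using sym by blast
  next
    case 6
    then show ?thesis using in_boxes by (intro far)
  next
    case 7
    then show ?thesis using in_boxes assms(3) by (intro tileable_without_close) (auto simp: st)
  qed
  then show ?thesis by (simp add: tileable_without_def st)
qed

section \<open>Cubes of arbitrary side\<close>

lemma window:
  fixes lo hi s m :: int
  assumes "lo \<le> s" "s < hi" "lo + m \<le> hi" "3 \<le> m" "3 dvd hi - lo - m"
  shows "\<exists>w. lo \<le> w \<and> 3 dvd w - lo \<and> w \<le> s \<and> s < w + m \<and> w + m \<le> hi \<and> 3 dvd hi - (w + m)"
proof -
  obtain K where K: "hi - lo - m = 3 * K" using assms(5) by (elim dvdE)
  define k where "k = min ((s - lo) div 3) K"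
  have "3 * ((s - lo) div 3) \<le> s - lo" "s - lo < 3 * ((s - lo) div 3) + 3" by linarith+
  moreover have "0 \<le> (s - lo) div 3" using assms by simp
  moreover have "0 \<le> K" using K assms by simp
  ultimately have "0 \<le> k" "3 * k \<le> s - lo" "s - lo < 3 * k + m" "k \<le> K"
    using assms K unfolding k_def min_def by (auto split: if_splits)
  moreover have "hi - (lo + 3 * k + m) = 3 * (K - k)" using K by simp
  moreover from this have "3 dvd hi - (lo + 3 * k + m)" by (metis dvd_triv_left)
  ultimately show ?thesis
    using K by (intro exI[of _ "lo + 3 * k"]) auto
qed

text \<open>Let \<open>3 * k\<close> be the largest multiple of 3 not above \<open>s\<close>. Either the interval of length 5 starting there
contains \<open>t\<close>, or \<open>t\<close> lies beyond it, and then a cut one step before its end separates \<open>s\<close> from \<open>t\<close> and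
leaves two parts of length 1 modulo 3. Near the upper end the interval is pushed back into the range.\<close>

lemma window_or_cut:
  fixes s t n :: int
  assumes "0 \<le> s" "s \<le> t" "t < n" "5 \<le> n" "n mod 3 = 2"
  obtains w where "0 \<le> w" "3 dvd w" "w \<le> s" "t < w + 5" "w + 5 \<le> n" "3 dvd n - (w + 5)"
  | p where "s < p" "p \<le> t" "4 \<le> p" "p + 4 \<le> n" "3 dvd p - 4" "3 dvd n - p - 4"
proof -
  define k where "k = s div 3"
  have k: "3 * k \<le> s" "s < 3 * k + 3" "0 \<le> k" using assms(1) by (auto simp: k_def)
  define N where "N = n div 3 - 1"
  have N: "n = 3 * N + 5"
    using div_mult_mod_eq[of n 3] assms(5) by (simp add: N_def)
  show thesis
  proof (cases "t < 3 * min k N + 5")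
    case True
    then show thesis using that(1)[of "3 * min k N"] k N assms
      by (auto simp: min_def)
  next
    case False
    then have "k < N" "3 * k + 5 \<le> t"
      using N assms(3) by (auto simp: min_def split: if_splits)
    then show thesis using that(2)[of "3 * k + 4"] k N by simp
  qed
qed

text \<open>One removed cell always lies in a translate of the small box whose distances to the faces of the
large box are multiples of 3.\<close>

lemma singly_tileable_windows:
  assumes base: "\<And>a b c. singly_tileable (a, b, c) (a + l, b + m, c + k)"
    and "3 \<le> l" "a + l \<le> a'" "3 dvd a' - a - l"
    and "3 \<le> m" "b + m \<le> b'" "3 dvd b' - b - m"
    and "3 \<le> k" "c + k \<le> c'" "3 dvd c' - c - k"
  shows "singly_tileable (a, b, c) (a', b', c')"
  unfolding singly_tileable_def
proof
  fix s assume s: "s \<in> box (a, b, c) (a', b', c')"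
  obtain x y z where xyz: "s = (x, y, z)" by (cases s)
  obtain u where u: "a \<le> u" "3 dvd u - a" "u \<le> x" "x < u + l" "u + l \<le> a'" "3 dvd a' - (u + l)"
    using window[of a x a' l] s assms(2-4) by (auto simp: xyz)
  obtain v where v: "b \<le> v" "3 dvd v - b" "v \<le> y" "y < v + m" "v + m \<le> b'" "3 dvd b' - (v + m)"
    using window[of b y b' m] s assms(5-7) by (auto simp: xyz)
  obtain w where w: "c \<le> w" "3 dvd w - c" "w \<le> z" "z < w + k" "w + k \<le> c'" "3 dvd c' - (w + k)"
    using window[of c z c' k] s assms(8-10) by (auto simp: xyz)
  show "tileable (box (a, b, c) (a', b', c') - {s})"
  proof (rule tileable_enlarge)
    show "tileable (box (u, v, w) (u + l, v + m, w + k) - {s})"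
      using base u v w by (intro singly_tileableD) (auto simp: xyz)
  qed (use u v w assms in \<open>auto simp: xyz\<close>)
qed

lemma doubly_deficient_cube_5_anywhere:
  assumes "in_box (a, b, c) (a + 5, b + 5, c + 5) s" "in_box (a, b, c) (a + 5, b + 5, c + 5) t" "s \<noteq> t"
  shows "tileable (box (a, b, c) (a + 5, b + 5, c + 5) - {s, t})"
proof -
  obtain x y z x' y' z' where st: "s = (x, y, z)" "t = (x', y', z')"
    by (cases s; cases t)
  define s0 t0 where "s0 = (x - (a - 1), y - (b - 1), z - (c - 1))"
    and "t0 = (x' - (a - 1), y' - (b - 1), z' - (c - 1))"
  have "tileable (box (1, 1, 1) (6, 6, 6) - {s0, t0})"
    using assms by (intro doubly_deficient_cube_5) (auto simp: s0_def t0_def st)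
  then show ?thesis
    using tileable_translate_box[of 1 "a - 1" 1 "b - 1" 1 "c - 1" 6 6 6 "{s0, t0}"]
    by (simp add: s0_def t0_def st algebra_simps)
qed

text \<open>If on every axis an interval of length 5 with offset divisible by 3 contains both coordinates, adding
slabs reduces the problem to the cube of side 5. Otherwise, on some axis, a plane cuts the cube
into two parts with one removed cell each and thickness 1 modulo 3; their other sides are 2 modulo 3, so
that adding slabs reduces each part to a 5 by 5 by 4 box.\<close>

lemma doubly_deficient_cube:
  fixes n :: int
  assumes n: "5 \<le> n" "n mod 3 = 2"
    and s: "in_box (1, 1, 1) (n + 1, n + 1, n + 1) s"
    and t: "in_box (1, 1, 1) (n + 1, n + 1, n + 1) t" and "s \<noteq> t"
  shows "tileable (box (1, 1, 1) (n + 1, n + 1, n + 1) - {s, t})"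
proof -
  let ?B = "box (1, 1, 1) (n + 1, n + 1, n + 1)"
  define windowed where "windowed u v \<longleftrightarrow> (\<exists>w. 1 \<le> w \<and> 3 dvd w - 1 \<and> w \<le> u \<and> u < w + 5 \<and>
    w \<le> v \<and> v < w + 5 \<and> w + 5 \<le> n + 1 \<and> 3 dvd n + 1 - (w + 5))" for u v
  have ordered_cut: "tileable (?B - {(x, y, z), (x', y', z')})"
    if "\<not> windowed z z'" "z \<le> z'" and in_boxes: "in_box (1, 1, 1) (n + 1, n + 1, n + 1) (x, y, z)"
      "in_box (1, 1, 1) (n + 1, n + 1, n + 1) (x', y', z')" for x y z x' y' z'
  proof -
    have "0 \<le> z - 1" "z - 1 \<le> z' - 1" "z' - 1 < n" using that by auto
    then show ?thesis using n
    proof (cases rule: window_or_cut)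
      case (1 w)
      then have "windowed z z'"
        unfolding windowed_def using \<open>z \<le> z'\<close> by (intro exI[of _ "w + 1"]) (auto simp: algebra_simps)
      then show ?thesis using that(1) by blast
    next
      case (2 p)
      have n5: "3 dvd n + 1 - 1 - 5" using n(2) by presburger
      show ?thesis
      proof (rule tileable_cut_pair_z[where m = "p + 1"])
        show "singly_tileable (1, 1, 1) (n + 1, n + 1, p + 1)"
          by (rule singly_tileable_windows[OF singly_tileable_5_5_4]) (use 2 n n5 in auto)
        have "n + 1 - (p + 1) - 4 = n - p - 4" by simp
        then show "singly_tileable (1, 1, p + 1) (n + 1, n + 1, n + 1)"
          by (intro singly_tileable_windows[OF singly_tileable_5_5_4]) (use 2 n n5 in auto)
      qed (use 2 in_boxes in auto)
    qed
  qed
  \<comment> \<open>A height difference in either order is handled by exchanging the two cells.\<close>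
  have cut: "tileable (?B - {(x, y, z), (x', y', z')})"
    if "\<not> windowed z z'" "in_box (1, 1, 1) (n + 1, n + 1, n + 1) (x, y, z)"
      "in_box (1, 1, 1) (n + 1, n + 1, n + 1) (x', y', z')" for x y z x' y' z'
  proof (cases "z \<le> z'")
    case True
    then show ?thesis using ordered_cut that by blast
  next
    case False
    have "\<not> windowed z' z" using that(1) by (auto simp: windowed_def)
    then have "tileable (?B - {(x', y', z'), (x, y, z)})" using ordered_cut that False by simp
    then show ?thesis by (simp add: insert_commute[of "(x, y, z)"])
  qed
  obtain x y z x' y' z' where st: "s = (x, y, z)" "t = (x', y', z')"
    by (cases s; cases t)
  show ?thesis
  proof (cases "windowed x x' \<and> windowed y y' \<and> windowed z z'")
    case True
    then obtain u v w where
      u: "1 \<le> u" "3 dvd u - 1" "u \<le> x" "x < u + 5" "u \<le> x'" "x' < u + 5"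
        "u + 5 \<le> n + 1" "3 dvd n + 1 - (u + 5)" and
      v: "1 \<le> v" "3 dvd v - 1" "v \<le> y" "y < v + 5" "v \<le> y'" "y' < v + 5"
        "v + 5 \<le> n + 1" "3 dvd n + 1 - (v + 5)" and
      w: "1 \<le> w" "3 dvd w - 1" "w \<le> z" "z < w + 5" "w \<le> z'" "z' < w + 5"
        "w + 5 \<le> n + 1" "3 dvd n + 1 - (w + 5)"
      unfolding windowed_def by auto
    show ?thesis
    proof (rule tileable_enlarge)
      show "tileable (box (u, v, w) (u + 5, v + 5, w + 5) - {s, t})"
        using u v w \<open>s \<noteq> t\<close> by (intro doubly_deficient_cube_5_anywhere) (auto simp: st)
      show "{s, t} \<subseteq> box (u, v, w) (u + 5, v + 5, w + 5)"
        using u v w by (auto simp: st)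
    qed (use u v w in auto)
  next
    case False
    then consider "\<not> windowed x x'" | "\<not> windowed y y'" | "\<not> windowed z z'" by blast
    then show ?thesis
    proof cases
      case 1
      then have "tileable (?B - {(y, z, x), (y', z', x')})"
        using s t by (intro cut) (auto simp: st)
      then have "tileable (?B - {(y, x, z), (y', x', z')})"
        using tileable_diff_swap_yz[where S = "{(y, z, x), (y', z', x')}"] by simp
      then show ?thesis
        using tileable_diff_swap_xy[where S = "{(y, x, z), (y', x', z')}"] by (simp add: st)
    next
      case 2
      then have "tileable (?B - {(x, z, y), (x', z', y')})"
        using s t by (intro cut) (auto simp: st)
      then show ?thesis
        using tileable_diff_swap_yz[where S = "{(x, z, y), (x', z', y')}"] by (simp add: st)
    next
      case 3
      then show ?thesis using s t unfolding st by (intro cut)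
    qed
  qed
qed

lemma cube_eq_box: "cube n = box (1, 1, 1) (int n + 1, int n + 1, int n + 1)"
  by (auto simp: cube_def)

theorem mainTheorem1:
  fixes n :: nat
  assumes "n > 0"
  shows "(n mod 3 = 0 \<longrightarrow> tileable (cube n)) \<and>
         (n mod 3 = 1 \<longrightarrow> (\<forall>a\<in>cube n. tileable (cube n - {a}))) \<and>
         (n mod 3 = 2 \<longrightarrow>
            (\<forall>a\<in>cube n. \<forall>b\<in>cube n. a \<noteq> b \<longrightarrow> tileable (cube n - {a, b})))"
proof (intro conjI impI ballI)
  assume 0: "n mod 3 = 0"
  then have "3 dvd int n" "3 \<le> n" using assms by presburger+
  then show "tileable (cube n)"
    unfolding cube_eq_box by (intro tileable_slab_x) auto
next
  fix a
  assume 1: "n mod 3 = 1" and a: "a \<in> cube n"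
  show "tileable (cube n - {a})"
  proof (cases "n = 1")
    case True
    then have "cube n - {a} = {}" using a by (auto simp: cube_def)
    then show ?thesis using tileable_empty by metis
  next
    case False
    then have "4 \<le> n" "3 dvd int n - 4" using 1 by presburger+
    then have "singly_tileable (1, 1, 1) (int n + 1, int n + 1, int n + 1)"
      by (intro singly_tileable_windows[OF singly_tileable_cube_4]) auto
    then show ?thesis using a unfolding cube_eq_box singly_tileable_def by blast
  qed
next
  fix a b
  assume 2: "n mod 3 = 2" and ab: "a \<in> cube n" "b \<in> cube n" "a \<noteq> b"
  show "tileable (cube n - {a, b})"
  proof (cases "n = 2")
    case True
    then show ?thesis
      using ab tileable_cube_2[of 1 1 1 a b] by (simp add: cube_eq_box)
  next
    case False
    then have "5 \<le> int n" "int n mod 3 = 2" using 2 by presburger+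
    then show ?thesis
      using doubly_deficient_cube ab by (simp add: cube_eq_box)
  qed
qed

end
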